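(* Let $L$ be a multiset of odd integers greater than $1$, let $a\in\{0,1\}$, and set $\epsilon_1=7^{|L|+a-1}\big(2\max(L)+1\big)$ if $L\ne\emptyset$ and $\epsilon_1=3$ if $L=\emptyset$. Then there exists $\epsilon\in\mathcal{I}\!\left(\sum_{\ell\in L}\ell+2a+1,\ \epsilon_1\right)$ such that $\left[L,{}^a2\ \middle|\ \epsilon-\sum_{\ell\in L}\ell-2a\right]_\epsilon$ has a $\mathcal{GL}(x,y)$ with $0\le x\le\frac{\epsilon-1}{2}$ and $x<y$.
   Context: $\mathcal{I}(a,b)=\{x\in\mathbb{Z}\mid a\le x\le b\}$; $|L|$ counts multiplicity. For a multiset $L$ of integers $\ge 2$ and $m\ge 0$, $[L\mid m]$ is the vertex-disjoint union of one $\ell$-cycle for each $\ell\in L$ and a path with $m$ edges; $[L,{}^a2\mid m]$ means $L$ together with $a$ copies of $2$ (a $2$-cycle being two vertices joined by two parallel edges); the subscript $\epsilon$ is the number of edges. A labeling is an isomorphic copy with distinct integer vertices; $\Delta\Gamma$ is the multiset of differences $u-w$ over ordered pairs of adjacent vertices (parallel edges counted separately). A $\mathcal{GL}(x,y)$ of such a graph with $\epsilon$ edges and at most one $2$-cycle is a labeling $\Gamma$ with vertex set $\mathcal{I}(0,\epsilon)$, path end-vertices $x$ and $y$, and $\Delta\Gamma=\pm\mathcal{I}(1,\epsilon)$ if there is no $2$-cycle, $\Delta\Gamma=\pm\{1,3,3\}\cup\pm\mathcal{I}(4,\epsilon)$ (as multisets) if there is exactly one $2$-cycle. *)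

theory Defs
  imports Complex_Main "HOL-Library.Multiset"
begin

text \<open>
  Undirected multigraphs: an edge is the set of its two end-vertices, and parallel edges are
  recorded by multiplicity.
\<close>

record 'v multigraph =
  verts :: "'v set"
  edges :: "'v set multiset"

definition is_iso :: "('v \<Rightarrow> 'w) \<Rightarrow> 'v multigraph \<Rightarrow> 'w multigraph \<Rightarrow> bool" where
  "is_iso f G H \<longleftrightarrow>
     bij_betw f (verts G) (verts H) \<and> edges H = image_mset (\<lambda>e. f ` e) (edges G)"

text \<open>
  The graph \<open>[L | m]\<close>. The vertex \<open>Cyc l c j\<close> is the \<open>j\<close>-th vertex of the \<open>c\<close>-th cycle of length
  \<open>l\<close>, and \<open>Pth j\<close> is the \<open>j\<close>-th vertex of the path. For \<open>l = 2\<close> the indices \<open>j = 0, 1\<close>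
  contribute the same edge, which thus has multiplicity 2. The elements of \<open>L\<close> are meant to be
  at least 2.
\<close>

datatype vertex = Cyc nat nat nat | Pth nat

definition cycles_path :: "nat multiset \<Rightarrow> nat \<Rightarrow> vertex multigraph" where
  "cycles_path L m =
     \<lparr> verts = {Cyc l c j | l c j. c < count L l \<and> j < l} \<union> {Pth j | j. j \<le> m},
       edges = image_mset (\<lambda>(l, c, j). {Cyc l c j, Cyc l c (Suc j mod l)})
                 (mset_set {(l, c, j). c < count L l \<and> j < l})
             + image_mset (\<lambda>j. {Pth j, Pth (Suc j)}) (mset_set {j. j < m}) \<rparr>"

definition diffs :: "int multigraph \<Rightarrow> int multiset" where
  "diffs \<Gamma> = (\<Sum>e\<in>#edges \<Gamma>. image_mset (\<lambda>(u, w). u - w) (mset_set {(u, w). {u, w} = e}))"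

definition pm :: "int multiset \<Rightarrow> int multiset" where
  "pm M = M + image_mset uminus M"

text \<open>
  \<open>is_GL L m \<Gamma> x y\<close>: the graph \<open>\<Gamma>\<close> is a \<open>\<G>\<L>(x, y)\<close> of \<open>[L | m]\<close>. The number of 2-cycles of
  \<open>[L | m]\<close> is \<open>count L 2\<close>.
\<close>

definition is_GL :: "nat multiset \<Rightarrow> nat \<Rightarrow> int multigraph \<Rightarrow> int \<Rightarrow> int \<Rightarrow> bool" where
  "is_GL L m \<Gamma> x y \<longleftrightarrow>
     (let \<epsilon> = int (size (edges (cycles_path L m))) in
       count L 2 \<le> 1 \<and>
       (\<exists>f. is_iso f (cycles_path L m) \<Gamma> \<and> {f (Pth 0), f (Pth m)} = {x, y}) \<and>
       verts \<Gamma> = {0..\<epsilon>} \<and>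
       diffs \<Gamma> = (if count L 2 = 0 then pm (mset_set {1..\<epsilon>})
                   else pm {#1, 3, 3#} + pm (mset_set {4..\<epsilon>})))"

lemma sum_count_mult_eq_sum_mset:
  assumes "finite S" "set_mset L \<subseteq> S"
  shows "(\<Sum>l\<in>S. count L l * l) = sum_mset (L :: nat multiset)"
  using assms(2)
proof (induction L)
  case empty
  then show ?case by simp
next
  case (add k L)
  have "(\<Sum>l\<in>S. count (add_mset k L) l * l) = (\<Sum>l\<in>S. (if l = k then k else 0) + count L l * l)"
    by (intro sum.cong) auto
  also have "\<dots> = k + (\<Sum>l\<in>S. count L l * l)"
    using add.prems assms(1) by (simp add: sum.distrib)
  finally show ?case using add by simp
qed

lemma size_edges_cycles_path: "size (edges (cycles_path L m)) = sum_mset L + m"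
proof -
  have "{(l, c, j). c < count L l \<and> j < l} = (SIGMA l:set_mset L. {..<count L l} \<times> {..<l})"
    by (auto simp flip: count_greater_zero_iff)
  then have "card {(l, c, j). c < count L l \<and> j < l} = sum_mset L"
    by (simp add: sum_count_mult_eq_sum_mset)
  then show ?thesis by (simp add: cycles_path_def)
qed

end

theory Submission
  imports Defs
begin

text \<open>
  The cycles are added one at a time to a labeling of \<open>{0..e}\<close> whose path starts at \<open>x\<close>. The new
  vertices lie below 0 and above \<open>e\<close>, so an edge between the two sides has a difference greater
  than \<open>e\<close>. A new cycle of length \<open>2k + 1\<close> consists of a zigzag through the \<open>k\<close> low and \<open>k\<close> high
  labels next to the old ones and of one far vertex, joined to both ends of the zigzag. The path
  is continued from \<open>x\<close> through all remaining new labels; it has to avoid the label of the far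
  vertex and the one low-high difference that the far vertex uses. Of the two differences that lie
  just below and just above those of the zigzag, one is the difference of the edge joining the far
  vertex to the zigzag on its own side, the other that of the edge at \<open>x\<close>. Since either
  assignment is allowed, one of them works whenever \<open>e\<close> is not too small compared to \<open>k\<close>, and \<open>e\<close>
  grows by a factor of at most 7. The bound \<open>2 x < e\<close>, which controls this factor, is restored
  after each step by reflecting the labels and reversing the path. Starting with a longest cycle,
  or with the 2-cycle and a sufficiently long path, makes \<open>e\<close> large enough from the beginning.
\<close>

section \<open>Zigzag paths\<close>

text \<open>Only absolute differences are recorded; \<open>pm\<close> restores the signs at the
  end.\<close>

fun path_diffs :: "int list \<Rightarrow> int multiset" where
  "path_diffs (u # v # us) = add_mset \<bar>u - v\<bar> (path_diffs (v # us))"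
| "path_diffs _ = {#}"

lemma path_diffs_append:
  "xs \<noteq> [] \<Longrightarrow> ys \<noteq> [] \<Longrightarrow>
    path_diffs (xs @ ys) = path_diffs xs + path_diffs ys + {#\<bar>last xs - hd ys\<bar>#}"
proof (induction xs rule: path_diffs.induct)
  case ("2_2" v)
  then show ?case by (cases ys) auto
qed auto

lemma path_diffs_Cons:
  "ys \<noteq> [] \<Longrightarrow> path_diffs (x # ys) = path_diffs ys + {#\<bar>x - hd ys\<bar>#}"
  by (cases ys) auto

lemma path_diffs_rev [simp]: "path_diffs (rev xs) = path_diffs xs"
proof (induction xs rule: path_diffs.induct)
  case (1 u v us)
  then show ?case
    using path_diffs_append[of "rev us @ [v]" "[u]"] by (auto simp: abs_minus_commute)
qed auto

lemma path_diffs_reflect [simp]: "path_diffs (map ((-) c) xs) = path_diffs xs"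
  by (induction xs rule: path_diffs.induct) (auto simp: abs_minus_commute)

lemma image_mset_set_reflect:
  "image_mset ((-) c) (mset_set A) = mset_set ((-) c ` A)" for c :: int
  by (intro image_mset_mset_set) (auto simp: inj_on_def)

lemma reflect_simps [simp]:
  fixes c a b :: int
  shows "(-) c ` {a..b} = {c-b..c-a}" "(-) c ` {a..<b} = {c-b<..c-a}"
    "(-) c ` {a<..b} = {c-b..<c-a}"
  by auto

text \<open>Low labels are counted down from \<open>l\<close>, high labels up from \<open>h\<close>; an edge between the
  \<open>i\<close>-th low and the \<open>j\<close>-th high label then has difference \<open>h - l + (i + j)\<close>.\<close>

primrec zigzag :: "int \<Rightarrow> int \<Rightarrow> nat \<Rightarrow> int list" where
  "zigzag h l 0 = []"
| "zigzag h l (Suc n) = (h + int n) # (l - int n) # zigzag h l n"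

lemma zigzag_empty_iff [simp]: "zigzag h l n = [] \<longleftrightarrow> n = 0"
  by (cases n) auto

lemma hd_zigzag: "n > 0 \<Longrightarrow> hd (zigzag h l n) = h + int n - 1"
  by (cases n) auto

lemma last_zigzag: "n > 0 \<Longrightarrow> last (zigzag h l n) = l"
  by (induction n) (auto split: if_splits)

lemma length_zigzag [simp]: "length (zigzag h l n) = 2 * n"
  by (induction n) auto

lemma mset_zigzag:
  "mset (zigzag h l n) = mset_set {h..<h + int n} + mset_set {l - int n<..l}"
proof (induction n)
  case (Suc n)
  have "{h..<h + int (Suc n)} = insert (h + int n) {h..<h + int n}"
    "{l - int (Suc n)<..l} = insert (l - int n) {l - int n<..l}" by auto
  with Suc show ?case by simp
qed simp

lemma path_diffs_zigzag:
  assumes "l < h"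
  shows "path_diffs (zigzag h l n) = mset_set {h - l..<h - l + 2 * int n - 1}"
proof (induction n)
  case (Suc n)
  show ?case
  proof (cases n)
    case 0
    have "{h - l..<h - l + 1} = {h - l}" by auto
    with 0 show ?thesis using assms by (simp add: add.commute)
  next
    case (Suc m)
    let ?e = "h - l + 2 * int n"
    have "{h - l..<h - l + 2 * int (Suc n) - 1} = insert ?e (insert (?e - 1) {h - l..<?e - 1})"
      using Suc by auto
    then have "mset_set {h - l..<h - l + 2 * int (Suc n) - 1}
        = add_mset ?e (add_mset (?e - 1) (mset_set {h - l..<?e - 1}))"
      by simp
    with Suc.IH show ?thesis using assms Suc
      by (simp add: path_diffs_Cons hd_zigzag abs_if algebra_simps)
  qed
qed simp

text \<open>The recursion on \<open>n\<close> is a Euclidean algorithm on \<open>(n + 1, w + 1)\<close>: an initial zigzag takes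
  \<open>n\<close> to \<open>n - w - 1\<close>, reflection and reversal take \<open>w\<close> to \<open>n - 1 - w\<close>.\<close>

lemma spanning_path:
  assumes "w < n" "l < h"
  shows "\<exists>xs. xs \<noteq> [] \<and> mset xs = mset_set {h..<h + int n} + mset_set {l - int n<..l} \<and>
    path_diffs xs = mset_set {h - l..<h - l + 2 * int n - 1} \<and>
    hd xs = h + int w \<and> last xs = l - (int n - 1 - int w)"
  using assms
proof (induction n arbitrary: h l w rule: less_induct)
  case (less n)
  define P where "P = (\<lambda>h l w xs. xs \<noteq> [] \<and>
    mset xs = mset_set {h..<h + int n} + mset_set {l - int n<..l} \<and>
    path_diffs xs = mset_set {h - l..<h - l + 2 * int n - 1} \<and>
    hd xs = h + int w \<and> last xs = l - (int n - 1 - int w))"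
  have long: "\<exists>xs. P h l w xs" if n: "2 * w + 2 \<le> n" and lh: "l < h" for h l w
  proof -
    \<comment> \<open>The zigzag ends at \<open>l\<close>. Starting \<open>ys\<close> at
      \<open>?h + int w\<close>, with the same \<open>w\<close>, gives the joining edge the
      difference \<open>h - l + 2 w + 1\<close>, the one between those of the zigzag and those of
      \<open>ys\<close>.\<close>
    let ?h = "h + int w + 1" and ?l = "l - int w - 1" and ?n = "n - w - 1"
    have "?n < n" "w < ?n" "?l < ?h" using n lh by auto
    from less.IH[OF this] obtain ys where ys: "ys \<noteq> []" "mset ys = mset_set {?h..<?h + int ?n} + mset_set {?l - int ?n<..?l}"
      "path_diffs ys = mset_set {?h - ?l..<?h - ?l + 2 * int ?n - 1}"
      "hd ys = ?h + int w" "last ys = ?l - (int ?n - 1 - int w)"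
      by (elim exE conjE)
    have "P h l w (zigzag h l (w + 1) @ ys)"
      unfolding P_def
    proof (intro conjI)
      show "mset (zigzag h l (w + 1) @ ys) = mset_set {h..<h + int n} + mset_set {l - int n<..l}"
        unfolding mset_append mset_zigzag ys(2) using n
        by (intro multiset_eqI) (auto simp: count_mset_set')
      show "path_diffs (zigzag h l (w + 1) @ ys) = mset_set {h - l..<h - l + 2 * int n - 1}"
        using n lh ys(1)
        by (subst path_diffs_append)
          (auto simp: path_diffs_zigzag last_zigzag ys(3,4) count_mset_set' intro!: multiset_eqI
             simp del: zigzag.simps)
    qed (use n ys in \<open>auto simp: hd_zigzag of_nat_diff\<close>)
    then show ?thesis by blast
  qed
  consider "n = w + 1" | "2 * w + 2 \<le> n" | "n = 2 * w + 1" "w > 0" | "w + 1 < n" "n \<le> 2 * w"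
    using less.prems by linarith
  then have "\<exists>xs. P h l w xs"
  proof cases
    case 1
    have "P h l w (zigzag h l n)"
      unfolding P_def mset_zigzag using 1 less.prems
      by (simp add: path_diffs_zigzag hd_zigzag last_zigzag del: zigzag.simps)
    then show ?thesis by blast
  next
    case 2
    then show ?thesis using long less.prems by blast
  next
    case 3
    \<comment> \<open>Here \<open>w = n - 1 - w\<close>, so reflection and reversal return the same
      \<open>w\<close>, and an initial zigzag would leave only \<open>w\<close> labels on each side.
      Instead, the middle labels \<open>h + w\<close> and \<open>l - w\<close> become the ends, with
      two reflected zigzags in between.\<close>
    let ?ys = "map ((-) (h + l)) (zigzag h l w)"
    let ?zs = "map ((-) (h + l)) (zigzag (h + int w + 1) (l - int w - 1) w)"
    have *: "path_diffs ((h + int w) # ?ys @ ?zs @ [l - int w]) =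
      path_diffs ?ys + path_diffs ?zs +
      {#\<bar>h + int w - hd ?ys\<bar>, \<bar>last ?ys - hd ?zs\<bar>, \<bar>last ?zs - (l - int w)\<bar>#}"
      using 3 by (simp add: path_diffs_Cons path_diffs_append)
    have "P h l w ((h + int w) # ?ys @ ?zs @ [l - int w])"
      unfolding P_def
    proof (intro conjI)
      show "mset ((h + int w) # ?ys @ ?zs @ [l - int w]) =
          mset_set {h..<h + int n} + mset_set {l - int n<..l}"
        using 3
        by (intro multiset_eqI)
          (auto simp: mset_zigzag image_mset_set_reflect count_mset_set')
      show "path_diffs ((h + int w) # ?ys @ ?zs @ [l - int w]) =
          mset_set {h - l..<h - l + 2 * int n - 1}"
        unfolding * using 3 less.prems
        by (auto simp: path_diffs_zigzag hd_map last_map hd_zigzag last_zigzag count_mset_set'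
            intro!: multiset_eqI)
    qed (use 3 in auto)
    then show ?thesis by blast
  next
    case 4
    let ?v = "n - 1 - w"
    have "2 * ?v + 2 \<le> n" using 4 by simp
    then obtain xs where xs: "P h l ?v xs" using long less.prems by blast
    have "P h l w (map ((-) (h + l)) (rev xs))"
      using xs 4 unfolding P_def
      by (auto simp: hd_map last_map hd_rev last_rev image_mset_set_reflect algebra_simps)
    then show ?thesis by blast
  qed
  then show ?case unfolding P_def .
qed

text \<open>With one more high label than low ones, both ends are high, and
  \<open>2 * w \<noteq> m\<close> keeps them apart. If \<open>2 * w < m\<close>, the path zigzags
  inward from \<open>h + w\<close> to \<open>h\<close>, jumps to \<open>l - 2 w\<close> and follows
  a reflected \<open>spanning_path\<close>; otherwise reversal exchanges the ends.\<close>

lemma spanning_path_odd: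
  assumes "w \<le> m" "2 * w \<noteq> m" "l < h"
  shows "\<exists>xs. xs \<noteq> [] \<and> mset xs = mset_set {h..h + int m} + mset_set {l - int m<..l} \<and>
    path_diffs xs = mset_set {h - l..<h - l + 2 * int m} \<and>
    hd xs = h + int w \<and> last xs = h + (int m - int w)"
proof -
  define P where "P = (\<lambda>w xs. xs \<noteq> [] \<and>
    mset xs = mset_set {h..h + int m} + mset_set {l - int m<..l} \<and>
    path_diffs xs = mset_set {h - l..<h - l + 2 * int m} \<and>
    hd xs = h + int w \<and> last xs = h + (int m - int w))"
  have short: "\<exists>xs. P w xs" if w: "2 * w < m" for w
  proof -
    let ?h = "h + int w + 1" and ?l = "l - int w" and ?n = "m - w"
    have "w < ?n" "?l < ?h" using w assms by auto
    from spanning_path[OF this] obtain ys where ys: "ys \<noteq> []"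
      "mset ys = mset_set {?h..<?h + int ?n} + mset_set {?l - int ?n<..?l}"
      "path_diffs ys = mset_set {?h - ?l..<?h - ?l + 2 * int ?n - 1}"
      "hd ys = ?h + int w" "last ys = ?l - (int ?n - 1 - int w)"
      by (elim exE conjE)
    let ?us = "(h + int w) # map ((-) (h + l)) (zigzag h l w)"
    let ?vs = "map ((-) (?h + ?l)) ys"
    have us: "mset ?us = mset_set {h..h + int w} + mset_set {l - int w<..l}"
      "path_diffs ?us = mset_set {h - l..<h - l + 2 * int w}" "last ?us = h"
    proof -
      show "mset ?us = mset_set {h..h + int w} + mset_set {l - int w<..l}"
        by (intro multiset_eqI) (auto simp: mset_zigzag image_mset_set_reflect count_mset_set')
      show "path_diffs ?us = mset_set {h - l..<h - l + 2 * int w}"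
      proof (cases "w = 0")
        case False
        then show ?thesis using assms(3)
          by (auto simp: path_diffs_Cons path_diffs_zigzag hd_map hd_zigzag count_mset_set'
              intro!: multiset_eqI)
      qed simp
      show "last ?us = h" by (simp add: last_map last_zigzag)
    qed
    have "P w (?us @ ?vs)"
      unfolding P_def
    proof (intro conjI)
      show "mset (?us @ ?vs) = mset_set {h..h + int m} + mset_set {l - int m<..l}"
        unfolding mset_append us(1) mset_map ys(2) using w
        by (intro multiset_eqI) (auto simp: image_mset_set_reflect count_mset_set')
      have "path_diffs (?us @ ?vs) = path_diffs ?us + path_diffs ys + {#h - l + 2 * int w#}"
        using ys(1,4) us(3) assms(3) by (subst path_diffs_append) (auto simp: hd_map)
      then show "path_diffs (?us @ ?vs) = mset_set {h - l..<h - l + 2 * int m}"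
        unfolding us(2) ys(3) using w
        by (auto simp: count_mset_set' intro!: multiset_eqI)
    qed (use w ys in \<open>auto simp: last_map\<close>)
    then show ?thesis by blast
  qed
  have "\<exists>xs. P w xs"
  proof (cases "2 * w < m")
    case False
    with assms have "2 * (m - w) < m" by linarith
    with short obtain xs where "P (m - w) xs" by blast
    then have "P w (rev xs)" using assms unfolding P_def
      by (auto simp: hd_rev last_rev)
    then show ?thesis by blast
  qed (rule short)
  then show ?thesis unfolding P_def .
qed

text \<open>After a spanning path using the sums \<open>i + j < s\<close>, the path jumps to the outermost labels and
  zigzags back past the missing label. Passing it leaves one sum unused, and the number of labels
  is chosen such that this is the sum of the jump.\<close>

lemma punctured_path:
  assumes "2 * w \<le> s" "4 * w \<noteq> s" "l < h"
  shows "\<exists>xs c d. xs \<noteq> [] \<and>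
    (add_mset (l - int s - 1) (mset xs) = mset_set {h..<h + int d} + mset_set {l - int c<..l} \<or>
     add_mset (h + int s + 1) (mset xs) = mset_set {h..<h + int d} + mset_set {l - int c<..l}) \<and>
    add_mset (h - l + int s) (path_diffs xs) = mset_set {h - l..<h - l + int (c + d) - 1} \<and>
    hd xs = h + int w \<and> 3 * s + 4 \<le> c + d \<and> c + d \<le> 3 * s + 2 * w + 6"
proof (cases "odd s")
  case True
  then obtain m' where m': "s = 2 * m' + 1" by (elim oddE)
  define m where "m = m' + 1"
  have m: "s + 1 = 2 * m" "w < m" "m > 0" using m' assms by (auto simp: m_def)
  from spanning_path[OF m(2) assms(3)] obtain ys where ys: "ys \<noteq> []"
    "mset ys = mset_set {h..<h + int m} + mset_set {l - int m<..l}"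
    "path_diffs ys = mset_set {h - l..<h - l + 2 * int m - 1}"
    "hd ys = h + int w" "last ys = l - (int m - 1 - int w)"
    by (elim exE conjE)
  \<comment> \<open>The outer zigzag \<open>?us\<close> and the inner one \<open>?vs\<close> leave
    out \<open>l - 2 m\<close>, which is \<open>l - s - 1\<close>. The size \<open>m + w + 1\<close>
    gives the jump from \<open>ys\<close> the difference \<open>h - l + 4 m - 1\<close>, the one
    skipped at this gap.\<close>
  let ?us = "zigzag (h + 2 * int m) (l - 2 * int m - 1) (m + w + 1)"
  let ?vs = "zigzag (h + int m) (l - int m) m"
  let ?c = "3 * m + w + 2" and ?d = "3 * m + w + 1"
  have s: "int s = 2 * int m - 1" using m by linarith
  have "add_mset (l - int s - 1) (mset (ys @ ?us @ ?vs)) =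
      mset_set {h..<h + int ?d} + mset_set {l - int ?c<..l}"
    unfolding mset_append mset_zigzag ys(2) s
    by (intro multiset_eqI) (auto simp: count_mset_set')
  moreover have "path_diffs (ys @ ?us @ ?vs) = path_diffs ys + path_diffs ?us + path_diffs ?vs +
      {#\<bar>last ys - hd ?us\<bar>, \<bar>last ?us - hd ?vs\<bar>#}"
    using ys(1) m by (simp add: path_diffs_append del: zigzag.simps)
  then have "add_mset (h - l + int s) (path_diffs (ys @ ?us @ ?vs)) =
      mset_set {h - l..<h - l + int (?c + ?d) - 1}"
    using m(3) assms(3) unfolding ys(3,5) s
    by (auto simp: path_diffs_zigzag hd_zigzag last_zigzag count_mset_set'
        intro!: multiset_eqI simp del: zigzag.simps)
  ultimately show ?thesis using ys(1,4) m by (intro exI[of _ "ys @ ?us @ ?vs"] exI[of _ ?c] exI[of _ ?d]) auto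
next
  case False
  then obtain m where m': "s = 2 * m" by (auto elim: evenE)
  \<comment> \<open>For even \<open>s\<close>, the \<open>s\<close> smallest sums take
    \<open>m + 1\<close> high and \<open>m\<close> low labels, so both ends of \<open>ys\<close> are
    high and \<open>4 * w \<noteq> s\<close> is needed. The zigzags are reflected, and the missing
    label is high.\<close>
  have m: "w \<le> m" "2 * w \<noteq> m" "m > 0" using m' assms by auto
  from spanning_path_odd[OF m(1,2) assms(3)] obtain ys where ys: "ys \<noteq> []"
    "mset ys = mset_set {h..h + int m} + mset_set {l - int m<..l}"
    "path_diffs ys = mset_set {h - l..<h - l + 2 * int m}"
    "hd ys = h + int w" "last ys = h + (int m - int w)"
    by (elim exE conjE)
  let ?us = "map ((-) (h + l + 2)) (zigzag (h + 2 * int m + 2) (l - 2 * int m) (m + w + 1))"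
  let ?vs = "map ((-) (h + l + 1)) (zigzag (h + int m + 1) (l - int m) m)"
  let ?c = "3 * m + w + 1" and ?d = "3 * m + w + 3"
  have "add_mset (h + int s + 1) (mset (ys @ ?us @ ?vs)) =
      mset_set {h..<h + int ?d} + mset_set {l - int ?c<..l}"
    unfolding mset_append mset_map mset_zigzag ys(2) m'
    by (intro multiset_eqI) (auto simp: image_mset_set_reflect count_mset_set')
  moreover have "path_diffs (ys @ ?us @ ?vs) = path_diffs ys + path_diffs ?us + path_diffs ?vs +
      {#\<bar>last ys - hd ?us\<bar>, \<bar>last ?us - hd ?vs\<bar>#}"
    using ys(1) m by (simp add: path_diffs_append del: zigzag.simps)
  then have "add_mset (h - l + int s) (path_diffs (ys @ ?us @ ?vs)) =
      mset_set {h - l..<h - l + int (?c + ?d) - 1}"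
    using m(3) assms(3) unfolding ys(3,5) m'
    by (auto simp: path_diffs_zigzag hd_zigzag last_zigzag hd_map last_map count_mset_set'
        intro!: multiset_eqI simp del: zigzag.simps)
  ultimately show ?thesis using ys(1,4) m m'
    by (intro exI[of _ "ys @ ?us @ ?vs"] exI[of _ ?c] exI[of _ ?d]) auto
qed

section \<open>Labelings as lists\<close>

text \<open>A list of two labels yields its difference twice, as a 2-cycle must.\<close>

definition cycle_diffs :: "int list \<Rightarrow> int multiset" where
  "cycle_diffs xs = path_diffs (last xs # xs)"

definition graceful_diffs :: "nat \<Rightarrow> int \<Rightarrow> int multiset" where
  "graceful_diffs a e = (if a = 0 then mset_set {1..e} else {#1, 3, 3#} + mset_set {4..e})"

text \<open>The interval is arbitrary because new labels are placed on both sides of the old ones.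
  Equality with \<open>mset_set\<close> says at once that the labels are distinct and fill the
  interval.\<close>

definition labeled :: "nat \<Rightarrow> int list list \<Rightarrow> int list \<Rightarrow> int \<Rightarrow> int \<Rightarrow> bool" where
  "labeled a cs p lo hi \<longleftrightarrow> 2 \<le> length p \<and> mset (concat cs @ p) = mset_set {lo..hi} \<and>
    (\<Sum>c\<leftarrow>cs. cycle_diffs c) + path_diffs p = graceful_diffs a (hi - lo)"

lemma graceful_diffs_extend:
  assumes "0 \<le> e" "a = 0 \<or> 3 \<le> e" "e \<le> e'"
  shows "graceful_diffs a e + mset_set {e + 1..e'} = graceful_diffs a e'"
  unfolding graceful_diffs_def using assms by (auto simp: count_mset_set' intro!: multiset_eqI)

section \<open>Symmetries of labelings\<close>

lemma cycle_diffs_reflect [simp]: "cycle_diffs (map ((-) c) xs) = cycle_diffs xs"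
proof (cases "xs = []")
  case False
  then have "last (map ((-) c) xs) # map ((-) c) xs = map ((-) c) (last xs # xs)"
    by (simp add: last_map)
  then show ?thesis unfolding cycle_diffs_def by (metis path_diffs_reflect)
qed (simp add: cycle_diffs_def)

lemma labeled_reflect:
  assumes "labeled a cs p lo hi"
  shows "labeled a (map (map ((-) c)) cs) (map ((-) c) p) (c - hi) (c - lo)"
proof -
  have "mset (concat (map (map ((-) c)) cs) @ map ((-) c) p) = image_mset ((-) c) (mset (concat cs @ p))"
    by (simp flip: map_concat)
  also have "\<dots> = mset_set {c - hi..c - lo}"
    using assms by (simp add: labeled_def image_mset_set_reflect del: mset_append)
  finally show ?thesis using assms by (simp add: labeled_def o_def)
qed

lemma labeled_shift:
  assumes "labeled a cs p lo hi"
  shows "labeled a (map (map ((+) c)) cs) (map ((+) c) p) (lo + c) (hi + c)"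
proof -
  have "(-) c \<circ> (-) 0 = (+) c" for c :: int by auto
  then show ?thesis
    using labeled_reflect[OF labeled_reflect[OF assms, of 0], of c] by (simp add: add.commute)
qed

lemma labeled_rev: "labeled a cs p lo hi \<Longrightarrow> labeled a cs (rev p) lo hi"
  by (simp add: labeled_def)

lemma mset_eq_mset_setD:
  assumes "mset xs = mset_set A" "finite A"
  shows "distinct xs" "set xs = A"
proof -
  show "set xs = A" using assms by (metis finite_set_mset_mset_set set_mset_mset)
  show "distinct xs"
    using assms by (simp add: distinct_count_atmost_1 count_mset_set' \<open>set xs = A\<close>)
qed

lemma labeled_ends:
  assumes "labeled a cs p lo hi"
  shows "hd p \<noteq> last p" "hd p \<in> {lo..hi}" "last p \<in> {lo..hi}"
proof -
  have len: "2 \<le> length p" and m: "mset (concat cs @ p) = mset_set {lo..hi}"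
    using assms by (auto simp: labeled_def)
  note d = mset_eq_mset_setD[OF m finite_atLeastAtMost_int]
  from len have "p \<noteq> []" by auto
  with d(2) show "hd p \<in> {lo..hi}" "last p \<in> {lo..hi}" by auto
  from d(1) len show "hd p \<noteq> last p"
    by (cases p) auto
qed

lemma labeled_normalize:
  assumes "labeled a cs p lo hi"
  obtains cs' p' where "labeled a cs' p' 0 (hi - lo)" "map length cs' = map length cs"
    "hd p' < last p'" "2 * hd p' < hi - lo"
proof -
  let ?cs = "map (map ((-) hi)) cs"
  obtain q where q: "labeled a ?cs q 0 (hi - lo)" "hd q < last q"
  proof -
    have *: "labeled a ?cs (map ((-) hi) p) 0 (hi - lo)"
      using labeled_reflect[OF assms, of hi] by simp
    show ?thesis
    proof (cases "hd (map ((-) hi) p) < last (map ((-) hi) p)")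
      case True
      then show ?thesis using * that by blast
    next
      case False
      with labeled_ends(1)[OF *] labeled_rev[OF *] show ?thesis
        by (intro that[of "rev (map ((-) hi) p)"]) (auto simp: hd_rev last_rev)
    qed
  qed
  show ?thesis
  proof (cases "2 * hd q < hi - lo")
    case True
    show ?thesis by (rule that[OF q(1) _ q(2) True]) simp
  next
    case False
    \<comment> \<open>Reflection and reversal together keep the order of the ends and move the start
      to \<open>hi - lo - last q\<close>, which is less than \<open>hi - lo - hd q\<close> and hence
      below the middle.\<close>
    let ?q = "rev (map ((-) (hi - lo)) q)"
    have "q \<noteq> []" using q by (auto simp: labeled_def)
    then have "hd ?q = hi - lo - last q" "last ?q = hi - lo - hd q"
      by (auto simp: hd_rev last_rev hd_map last_map)
    moreover have "labeled a (map (map ((-) (hi - lo))) ?cs) ?q 0 (hi - lo)"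
      using labeled_rev[OF labeled_reflect[OF q(1), of "hi - lo"]] by simp
    ultimately show ?thesis
      by (intro that[of "map (map ((-) (hi - lo))) ?cs" ?q]) (use q(2) False in auto)
  qed
qed

section \<open>Adding a cycle\<close>

text \<open>The two alternatives are the two assignments of the differences \<open>e + 1\<close> and \<open>e + 2 k + 1\<close> to
  the edge inside one side of the new cycle and to the edge at \<open>x\<close>. In each of them, the inequality
  and the inequation are the hypotheses of \<open>punctured_path\<close>.\<close>

definition attachable :: "int \<Rightarrow> int \<Rightarrow> int \<Rightarrow> bool" where
  "attachable e x k \<longleftrightarrow>
    2 * (x + k) \<le> e - k \<and> 4 * (x + k) \<noteq> e - k \<or>
    k \<le> x \<and> 2 * (x - k) \<le> e + k \<and> 4 * (x - k) \<noteq> e + k"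

text \<open>The second alternative fails only if \<open>x < k\<close>, where the first is clear, or
  if \<open>4 * x = e + 5 * k\<close>. In the latter case \<open>2 * (x + k) \<le> e - k\<close>
  amounts to \<open>11 * k \<le> e\<close>, and \<open>4 * (x + k) = e + 9 * k\<close>.\<close>

lemma attachable_large:
  assumes "11 * k \<le> e" "0 \<le> x" "2 * x < e" "1 \<le> k"
  shows "attachable e x k"
proof (cases "k \<le> x \<and> 4 * (x - k) \<noteq> e + k")
  case True
  then show ?thesis using assms unfolding attachable_def by simp
next
  case False
  then show ?thesis using assms unfolding attachable_def by auto
qed

lemma add_cycle:
  assumes lab: "labeled a cs p 0 e" and e: "a = 0 \<or> 3 \<le> e"
    and x: "2 * hd p < e" and k: "0 < k" and att: "attachable e (hd p) (int k)"
  obtains C p' lo hi where "length C = 2 * k + 1" "labeled a (C # cs) p' lo hi"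
    "4 * e - int k + 4 \<le> hi - lo" "hi - lo \<le> 5 * e + 3 * int k + 5"
proof -
  have x0: "0 \<le> hd p" "hd p \<le> e" using labeled_ends(2)[OF lab] by auto
  have len: "2 \<le> length p" and ms: "mset (concat cs @ p) = mset_set {0..e}"
    and ds: "(\<Sum>c\<leftarrow>cs. cycle_diffs c) + path_diffs p = graceful_diffs a e"
    using lab by (auto simp: labeled_def)
  obtain s w :: nat where sw: "2 * w \<le> s" "4 * w \<noteq> s"
    "int s = e - int k \<and> int w = hd p + int k \<or> int s = e + int k \<and> int w = hd p - int k"
  proof -
    consider "2 * (hd p + int k) \<le> e - int k" "4 * (hd p + int k) \<noteq> e - int k"
      | "int k \<le> hd p" "2 * (hd p - int k) \<le> e + int k" "4 * (hd p - int k) \<noteq> e + int k"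
      using att unfolding attachable_def by blast
    then show ?thesis
    proof cases
      case 1
      then show ?thesis using x0 by (intro that[of "nat (hd p + int k)" "nat (e - int k)"]) auto
    next
      case 2
      then show ?thesis using x0 by (intro that[of "nat (hd p - int k)" "nat (e + int k)"]) auto
    qed
  qed
  \<comment> \<open>The zigzag \<open>?Z\<close> below takes the differences from
    \<open>e + 2\<close> to \<open>e + 2 k\<close>, and those from \<open>e + 2 k + 2\<close> on are
    left to \<open>Q\<close> and the far vertex. The other two, \<open>e + 1\<close> and
    \<open>e + 2 k + 1\<close>, are \<open>k + s + 1\<close> at the far vertex and
    \<open>?h + w - hd p\<close> at the edge to \<open>hd p\<close>, in either order.\<close>
  let ?h = "e + 1 + int k" and ?l = "- 1 - int k"
  have "?l < ?h" using x0 by linarith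
  from punctured_path[OF sw(1,2) this] obtain Q c d where Q: "Q \<noteq> []"
    "add_mset (?l - int s - 1) (mset Q) = mset_set {?h..<?h + int d} + mset_set {?l - int c<..?l} \<or>
     add_mset (?h + int s + 1) (mset Q) = mset_set {?h..<?h + int d} + mset_set {?l - int c<..?l}"
    "add_mset (?h - ?l + int s) (path_diffs Q) = mset_set {?h - ?l..<?h - ?l + int (c + d) - 1}"
    "hd Q = ?h + int w" "3 * s + 4 \<le> c + d" "c + d \<le> 3 * s + 2 * w + 6"
    by (elim exE conjE)
  let ?Z = "zigzag (e + 1) (- 1) k"
  obtain C where C: "length C = 2 * k + 1"
    "mset C + mset Q = mset ?Z + (mset_set {?h..<?h + int d} + mset_set {?l - int c<..?l})"
    "cycle_diffs C = path_diffs ?Z + {#?h - ?l + int s, int k + int s + 1#}"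
    using Q(2)
  proof
    assume "add_mset (?l - int s - 1) (mset Q) = mset_set {?h..<?h + int d} + mset_set {?l - int c<..?l}"
    moreover have "cycle_diffs ((?l - int s - 1) # ?Z) =
        path_diffs ?Z + {#?h - ?l + int s, int k + int s + 1#}"
      unfolding cycle_diffs_def using k x0
      by (simp add: path_diffs_Cons last_zigzag hd_zigzag algebra_simps)
    ultimately show ?thesis
      by (intro that[of "(?l - int s - 1) # ?Z"]) (auto simp: add_ac)
  next
    \<comment> \<open>The far vertex is now high. The labels of \<open>?Z\<close> are invariant
      under \<open>(-) e\<close>, and the reflected zigzag ends at \<open>e + 1\<close>, again at
      distance \<open>k + s + 1\<close> from the far vertex.\<close>
    let ?Y = "map ((-) e) ?Z"
    assume "add_mset (?h + int s + 1) (mset Q) = mset_set {?h..<?h + int d} + mset_set {?l - int c<..?l}"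
    moreover have "cycle_diffs ((?h + int s + 1) # ?Y) =
        path_diffs ?Z + {#?h - ?l + int s, int k + int s + 1#}"
      unfolding cycle_diffs_def using k x0
      by (simp add: path_diffs_Cons last_zigzag hd_zigzag hd_map last_map algebra_simps)
    moreover have "mset ?Y = mset ?Z"
      by (simp add: mset_zigzag image_mset_set_reflect)
        (auto simp: count_mset_set' intro!: multiset_eqI)
    ultimately show ?thesis
      by (intro that[of "(?h + int s + 1) # ?Y"]) (auto simp: add_ac)
  qed
  let ?p = "rev Q @ p" and ?lo = "- int k - int c" and ?hi = "e + int k + int d"
  have "labeled a (C # cs) ?p ?lo ?hi"
    unfolding labeled_def
  proof (intro conjI)
    show "2 \<le> length ?p" using len by simp
    have "mset (concat (C # cs) @ ?p) = mset C + mset Q + mset (concat cs @ p)" by simp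
    also have "\<dots> = mset_set {?lo..?hi}"
      unfolding C(2) ms mset_zigzag using x0 by (auto simp: count_mset_set' intro!: multiset_eqI)
    finally show "mset (concat (C # cs) @ ?p) = mset_set {?lo..?hi}" .
    have "path_diffs ?p = path_diffs Q + path_diffs p + {#?h + int w - hd p#}"
      using Q(1,4) len x0 x by (subst path_diffs_append) (auto simp: last_rev)
    then have "(\<Sum>c\<leftarrow>C # cs. cycle_diffs c) + path_diffs ?p = graceful_diffs a e +
      (path_diffs ?Z + {#int k + int s + 1, ?h + int w - hd p#} +
        add_mset (?h - ?l + int s) (path_diffs Q))"
      using C(3) ds by (simp add: ac_simps flip: ds)
    also have "path_diffs ?Z + {#int k + int s + 1, ?h + int w - hd p#} +
        add_mset (?h - ?l + int s) (path_diffs Q) = mset_set {e + 1..?hi - ?lo}"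
      unfolding Q(3) using sw(3) x0 Q(5) k
      by (auto simp: path_diffs_zigzag count_mset_set' intro!: multiset_eqI)
    also have "graceful_diffs a e + mset_set {e + 1..?hi - ?lo} = graceful_diffs a (?hi - ?lo)"
      using e x0 by (intro graceful_diffs_extend) auto
    finally show "(\<Sum>c\<leftarrow>C # cs. cycle_diffs c) + path_diffs ?p = graceful_diffs a (?hi - ?lo)" .
  qed
  \<comment> \<open>The length is \<open>e + 2 k + c + d\<close>. The lower bound is attained for
    \<open>s = e - k\<close>; the upper one comes from \<open>s = e + k\<close> and
    \<open>2 x < e\<close>, where \<open>x = hd p\<close>.\<close>
  moreover have "4 * e - int k + 4 \<le> ?hi - ?lo" "?hi - ?lo \<le> 5 * e + 3 * int k + 5"
    using sw(3) Q(5,6) x by linarith+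
  ultimately show ?thesis using C(1) that by blast
qed

text \<open>\<open>K\<close> bounds the \<open>k\<close> of the cycles that remain to be added. After one step \<open>e\<close> is at least
  \<open>11 K\<close>, so the last conjunct is a condition on the initial labelings only.\<close>

definition attainable :: "nat \<Rightarrow> nat multiset \<Rightarrow> nat \<Rightarrow> int \<Rightarrow> bool" where
  "attainable a L K e \<longleftrightarrow> (\<exists>cs p. mset (map length cs) = L \<and> labeled a cs p 0 e \<and>
    hd p < last p \<and> 2 * hd p < e \<and> 5 \<le> e \<and> 3 * int K \<le> e \<and>
    (\<forall>k. 0 < k \<longrightarrow> k \<le> K \<longrightarrow> attachable e (hd p) (int k)))"

text \<open>The thresholds in \<open>attainable\<close> match \<open>add_cycle\<close>:
  \<open>3 K \<le> e\<close> gives \<open>4 e - k + 4 \<ge> 11 K\<close>, as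
  \<open>attachable_large\<close> requires, and together with \<open>5 \<le> e\<close> also
  \<open>5 e + 3 k + 5 \<le> 7 e\<close>.\<close>

lemma attainable_add_cycle:
  assumes "attainable a L K e" "0 < k" "k \<le> K"
  obtains e' where "attainable a (add_mset (2 * k + 1) L) K e'" "e' \<le> 7 * e"
proof -
  obtain cs p where csp: "mset (map length cs) = L" "labeled a cs p 0 e" "hd p < last p"
    "2 * hd p < e" "5 \<le> e" "3 * int K \<le> e"
    "attachable e (hd p) (int k)"
    using assms unfolding attainable_def by blast
  have "a = 0 \<or> 3 \<le> e" using csp(5) by simp
  then obtain C p' lo hi where C: "length C = 2 * k + 1" "labeled a (C # cs) p' lo hi"
    "4 * e - int k + 4 \<le> hi - lo" "hi - lo \<le> 5 * e + 3 * int k + 5"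
    by (rule add_cycle[OF csp(2) _ csp(4) assms(2) csp(7)])
  obtain cs' p'' where n: "labeled a cs' p'' 0 (hi - lo)" "map length cs' = map length (C # cs)"
    "hd p'' < last p''" "2 * hd p'' < hi - lo"
    using labeled_normalize[OF C(2)] by blast
  have "11 * int K \<le> hi - lo" using C(3) csp(6) assms(3) by linarith
  then have "attachable (hi - lo) (hd p'') (int j)" if "0 < j" "j \<le> K" for j
    using that n(4) labeled_ends(2)[OF n(1)] by (intro attachable_large) auto
  moreover have "mset (map length cs') = add_mset (2 * k + 1) L"
    using C(1) csp(1) unfolding n(2) by simp
  moreover have "5 \<le> hi - lo" "3 * int K \<le> hi - lo"
    using C(3) csp(5,6) assms(3) by linarith+
  ultimately have "attainable a (add_mset (2 * k + 1) L) K (hi - lo)"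
    unfolding attainable_def using n by blast
  moreover have "hi - lo \<le> 7 * e" using C(4) csp(5,6) assms(3) by linarith
  ultimately show ?thesis using that by blast
qed

lemma attainable_add_cycles:
  assumes "attainable a L K e" "\<And>l. l \<in># M \<Longrightarrow> odd l \<and> 1 < l \<and> l \<le> 2 * K + 1"
  shows "\<exists>e'. attainable a (M + L) K e' \<and> e' \<le> 7 ^ size M * e"
  using assms(2)
proof (induction M)
  case empty
  then show ?case using assms(1) by auto
next
  case (add l M)
  then obtain e' where e': "attainable a (M + L) K e'" "e' \<le> 7 ^ size M * e" by auto
  obtain k where k: "l = 2 * k + 1" "0 < k" "k \<le> K"
    using add.prems[of l] by (auto elim!: oddE)
  obtain e'' where "attainable a (add_mset l (M + L)) K e''" "e'' \<le> 7 * e'"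
    using attainable_add_cycle[OF e'(1) k(2,3)] k(1) by blast
  then show ?case using e'(2) by (intro exI[of _ e'']) auto
qed

section \<open>Initial labelings\<close>

text \<open>The largest difference goes to the edge at \<open>b\<close>: the shorter path is
  reflected so as to begin at \<open>b + n\<close>.\<close>

lemma graceful_path:
  "0 < n \<Longrightarrow> \<exists>p. length p = n \<and> hd p = b \<and> mset p = mset_set {b..<b + int n} \<and>
    path_diffs p = mset_set {1..<int n}"
proof (induction n rule: nat_induct_non_zero)
  case 1
  have "{b..<b + 1} = {b}" by auto
  then show ?case by (intro exI[of _ "[b]"]) simp
next
  case (Suc n)
  then obtain p where p: "length p = n" "hd p = b" "mset p = mset_set {b..<b + int n}"
    "path_diffs p = mset_set {1..<int n}" by blast
  let ?p = "b # map ((-) (2 * b + int n)) p"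
  have "p \<noteq> []" using p(1) Suc by auto
  then have "path_diffs ?p = add_mset (int n) (path_diffs p)"
    using p(2) by (simp add: path_diffs_Cons hd_map)
  then have "path_diffs ?p = mset_set {1..<int (Suc n)}"
    using p(4) Suc(1) by (auto simp: count_mset_set' intro!: multiset_eqI)
  moreover have "mset ?p = mset_set {b..<b + int (Suc n)}"
    using p(3) by (auto simp: image_mset_set_reflect count_mset_set' intro!: multiset_eqI)
  ultimately show ?case using p(1) by (intro exI[of _ ?p]) auto
qed

text \<open>A zigzag between the labels below \<open>K\<close> and those from \<open>2 K\<close> to
  \<open>3 K - 1\<close> is closed by \<open>3 K\<close>, which adds the differences
  \<open>K\<close> and \<open>3 K\<close>. A path on the middle labels provides the differences
  below \<open>K\<close>.\<close>

lemma attainable_single_cycle: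
  assumes "2 \<le> K"
  shows "attainable 0 {#2 * K + 1#} K (3 * int K)"
proof -
  obtain p where p: "length p = K" "hd p = int K" "mset p = mset_set {int K..<int K + int K}"
    "path_diffs p = mset_set {1..<int K}"
    using graceful_path[of K "int K"] assms by auto
  let ?Y = "map ((-) (3 * int K - 1)) (zigzag (2 * int K) (int K - 1) K)"
  let ?C = "(3 * int K) # ?Y"
  have lab: "labeled 0 [?C] p 0 (3 * int K)"
    unfolding labeled_def
  proof (intro conjI)
    show "mset (concat [?C] @ p) = mset_set {0..3 * int K}"
      using p(3) by (auto simp: mset_zigzag image_mset_set_reflect count_mset_set' intro!: multiset_eqI)
    have "cycle_diffs ?C = path_diffs ?Y + {#3 * int K, int K#}"
      unfolding cycle_diffs_def using assms
      by (simp add: path_diffs_Cons last_zigzag hd_zigzag hd_map last_map)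
    then show "(\<Sum>c\<leftarrow>[?C]. cycle_diffs c) + path_diffs p = graceful_diffs 0 (3 * int K - 0)"
      using p(4) assms
      by (auto simp: graceful_diffs_def path_diffs_zigzag count_mset_set' intro!: multiset_eqI)
  qed (use p assms in auto)
  \<comment> \<open>The second alternative fails only for \<open>K = 5 k\<close>, and then the first
    holds.\<close>
  have "attachable (3 * int K) (int K) (int k)" if "0 < k" "k \<le> K" for k
    using that unfolding attachable_def by auto
  moreover have "int K < last p"
  proof -
    have "last p \<in> set p" using p(1) assms by (intro last_in_set) auto
    then have "last p \<in># mset p" by simp
    then have "int K \<le> last p" by (simp add: p(3))
    moreover have "hd p \<noteq> last p" by (rule labeled_ends(1)[OF lab])
    ultimately show ?thesis using p(2) by simp
  qed
  ultimately show ?thesis unfolding attainable_def using assms p(2) lab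
    by (intro exI[of _ "[?C]"] exI[of _ p]) auto
qed

text \<open>For \<open>K = 1\<close> the previous construction would have a path without edges. The
  value 6 respects the common bound \<open>4 K + 3\<close>.\<close>

lemma attainable_triangle: "attainable 0 {#3#} 1 6"
proof -
  have s: "{0..6} = {0, 1, 2, 3, 4, 5, 6::int}" "{1..6} = {1, 2, 3, 4, 5, 6::int}" by auto
  have "labeled 0 [[2, 3, 5]] [1, 6, 0, 4] 0 6"
    unfolding labeled_def graceful_diffs_def cycle_diffs_def by (simp add: s add_mset_commute)
  then show ?thesis unfolding attainable_def
    by (intro exI[of _ "[[2, 3, 5]]"] exI[of _ "[1, 6, 0, 4]"])
      (auto simp: attachable_def le_Suc_eq)
qed

lemma labeled_digon: "labeled 1 [[0, 3]] [1, 2] 0 3"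
proof -
  have "{0..3} = {0, 1, 2, 3::int}" by auto
  then show ?thesis
    unfolding labeled_def graceful_diffs_def cycle_diffs_def by (simp add: add_mset_commute)
qed

text \<open>With \<open>w = 1\<close>, the spanning path starts at 5, so its edge to 1 has the
  difference 4, just below its own differences. Its outer end \<open>1 - n\<close> becomes 1 after
  the shift by \<open>n\<close>.\<close>

lemma labeled_digon_long_path:
  assumes "1 < n"
  obtains cs p where "map length cs = [2]" "labeled 1 cs p 0 (3 + 2 * int n)"
    "hd p = 1" "1 < last p"
proof -
  from assms have "-1 < (4::int)" by simp
  from spanning_path[OF assms this] obtain Q where Q: "Q \<noteq> []"
    "mset Q = mset_set {4..<4 + int n} + mset_set {-1 - int n<..-1}"
    "path_diffs Q = mset_set {4 - -1..<4 - -1 + 2 * int n - 1}"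
    "hd Q = 4 + int 1" "last Q = -1 - (int n - 1 - int 1)"
    by (elim exE conjE)
  let ?p = "rev Q @ [1, 2]"
  have "labeled 1 [[0, 3]] ?p (- int n) (3 + int n)"
    unfolding labeled_def
  proof (intro conjI)
    show "mset (concat [[0, 3]] @ ?p) = mset_set {- int n..3 + int n}"
      using Q(2) by (auto simp: count_mset_set' intro!: multiset_eqI)
    have "path_diffs ?p = path_diffs Q + {#4, 1#}"
      using Q(1,4) by (subst path_diffs_append) (auto simp: last_rev)
    then show "(\<Sum>c\<leftarrow>[[0, 3]]. cycle_diffs c) + path_diffs ?p = graceful_diffs 1 (3 + int n - - int n)"
      using Q(3) assms
      by (auto simp: graceful_diffs_def cycle_diffs_def count_mset_set' intro!: multiset_eqI)
  qed simp
  from labeled_shift[OF this, of "int n"] show ?thesis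
    using Q(1,5) by (intro that[of "[[int n, int n + 3]]" "map ((+) (int n)) ?p"])
      (auto simp: hd_rev hd_append hd_map algebra_simps)
qed

lemma attainable_digon:
  assumes "0 < K"
  obtains e where "attainable 1 {#2#} K e" "e \<le> 4 * int K + 3"
proof -
  \<comment> \<open>With \<open>x = 1\<close> and \<open>k > 1\<close>, the only large \<open>e\<close> to avoid is \<open>5 k + 4\<close>.\<close>
  define n where "n = (if 5 dvd 4 * int K - 1 then 2 * K - 1 else 2 * K)"
  have n1: "1 < n" using assms by (cases "K = 1") (auto simp: n_def)
  obtain cs p where csp: "map length cs = [2]" "labeled 1 cs p 0 (3 + 2 * int n)"
    "hd p = 1" "1 < last p"
    using labeled_digon_long_path[OF n1] by blast
  have att: "attachable (3 + 2 * int n) 1 (int k)" if "0 < k" "k \<le> K" for k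
  proof (cases "k = 1")
    case True
    then show ?thesis by (simp add: attachable_def)
  next
    case False
    show ?thesis
    proof (cases "5 dvd 4 * int K - 1")
      case True
      then obtain r where r: "4 * int K - 1 = 5 * r" by (elim dvdE)
      from True have "2 * int n = 4 * int K - 2" using assms by (simp add: n_def of_nat_diff)
      moreover have "4 * (1 + int k) \<noteq> 3 + (4 * int K - 2) - int k" using r by presburger
      ultimately show ?thesis using that unfolding attachable_def by simp
    next
      case False
      then have "2 * int n = 4 * int K" by (simp add: n_def)
      moreover have "4 * (1 + int k) \<noteq> 3 + 4 * int K - int k" using False by presburger
      ultimately show ?thesis using that \<open>k \<noteq> 1\<close> unfolding attachable_def by simp
    qed
  qed
  moreover have "3 * int K \<le> 3 + 2 * int n" "3 + 2 * int n \<le> 4 * int K + 3"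
    by (auto simp: n_def)
  moreover have "mset (map length cs) = {#2#}" by (simp add: csp(1))
  ultimately have "attainable 1 {#2#} K (3 + 2 * int n)"
    unfolding attainable_def using csp n1 att by (intro exI[of _ cs] exI[of _ p]) auto
  then show ?thesis using that \<open>3 + 2 * int n \<le> 4 * int K + 3\<close> by blast
qed

section \<open>From lists to multigraphs\<close>

fun path_edges :: "'a list \<Rightarrow> 'a set multiset" where
  "path_edges (u # v # us) = add_mset {u, v} (path_edges (v # us))"
| "path_edges _ = {#}"

lemma path_edges_snoc: "xs \<noteq> [] \<Longrightarrow> path_edges (xs @ [y]) = add_mset {last xs, y} (path_edges xs)"
  by (induction xs rule: path_edges.induct) auto

lemma path_edges_nth:
  "path_edges xs = image_mset (\<lambda>j. {xs ! j, xs ! Suc j}) (mset_set {j. Suc j < length xs})"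
proof (induction xs rule: path_edges.induct)
  case (1 u v us)
  have "{j. Suc j < length (u # v # us)} = insert 0 (Suc ` {j. Suc j < length (v # us)})"
    by (auto simp: image_iff gr0_conv_Suc) presburger
  moreover have "mset_set (Suc ` {j. Suc j < length (v # us)}) =
      image_mset Suc (mset_set {j. Suc j < length (v # us)})"
    by (simp add: image_mset_mset_set)
  ultimately show ?case using 1 by (simp add: multiset.map_comp o_def)
qed auto

text \<open>Moving the repeated vertex from the front to the end aligns the edges with the cyclic
  indices of \<open>cycles_path\<close>.\<close>

lemma closed_path_edges_nth:
  assumes "xs \<noteq> []"
  shows "path_edges (last xs # xs) =
    image_mset (\<lambda>j. {xs ! j, xs ! (Suc j mod length xs)}) (mset_set {..<length xs})"
proof -
  have "path_edges (last xs # xs) = path_edges (xs @ [hd xs])"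
    using assms by (cases xs) (auto simp: path_edges_snoc simp del: append_Cons)
  also have "\<dots> = image_mset (\<lambda>j. {(xs @ [hd xs]) ! j, (xs @ [hd xs]) ! Suc j}) (mset_set {..<length xs})"
    by (simp add: path_edges_nth lessThan_def)
  also have "\<dots> = image_mset (\<lambda>j. {xs ! j, xs ! (Suc j mod length xs)}) (mset_set {..<length xs})"
  proof (intro image_mset_cong)
    fix j assume "j \<in># mset_set {..<length xs}"
    then have "j < length xs" by simp
    then show "{(xs @ [hd xs]) ! j, (xs @ [hd xs]) ! Suc j} = {xs ! j, xs ! (Suc j mod length xs)}"
      using assms by (cases "Suc j = length xs") (auto simp: nth_append hd_conv_nth)
  qed
  finally show ?thesis .
qed

lemma cycle_index_finite: "finite {(l, c, j). c < count L l \<and> j < (l :: nat)}"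
proof -
  have "{(l, c, j). c < count L l \<and> j < l} = (SIGMA l:set_mset L. {..<count L l} \<times> {..<l})"
    by (auto simp flip: count_greater_zero_iff)
  then show ?thesis by simp
qed

lemma cycle_index_add:
  "{(l', c, j). c < count (add_mset l L) l' \<and> j < (l' :: nat)} =
    {(l', c, j). c < count L l' \<and> j < l'} \<union> (\<lambda>j. (l, count L l, j)) ` {..<l}"
  by (auto split: if_splits)

lemma verts_cycles_path_iff [simp]:
  "Cyc l c j \<in> verts (cycles_path L m) \<longleftrightarrow> c < count L l \<and> j < l"
  "Pth j \<in> verts (cycles_path L m) \<longleftrightarrow> j \<le> m"
  by (auto simp: cycles_path_def)

lemma verts_add_cycle:
  "verts (cycles_path (add_mset l L) m) =
    verts (cycles_path L m) \<union> Cyc l (count L l) ` {..<l}"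
proof (rule set_eqI)
  fix v
  show "v \<in> verts (cycles_path (add_mset l L) m) \<longleftrightarrow>
      v \<in> verts (cycles_path L m) \<union> Cyc l (count L l) ` {..<l}"
    by (cases v) auto
qed

lemma edges_add_cycle:
  "edges (cycles_path (add_mset l L) m) = edges (cycles_path L m) +
    image_mset (\<lambda>j. {Cyc l (count L l) j, Cyc l (count L l) (Suc j mod l)}) (mset_set {..<l})"
proof -
  let ?I = "\<lambda>L :: nat multiset. {(l', c, j). c < count L l' \<and> j < (l' :: nat)}"
  have "mset_set (?I (add_mset l L)) = mset_set (?I L) + mset_set ((\<lambda>j. (l, count L l, j)) ` {..<l})"
    unfolding cycle_index_add by (intro mset_set_Union cycle_index_finite) auto
  moreover have "mset_set ((\<lambda>j. (l, count L l, j)) ` {..<l}) =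
      image_mset (\<lambda>j. (l, count L l, j)) (mset_set {..<l})"
    by (intro image_mset_mset_set[symmetric]) (auto simp: inj_on_def)
  ultimately show ?thesis
    unfolding cycles_path_def by (simp add: multiset.map_comp o_def add_ac)
qed

lemma edge_subset_verts:
  assumes "e \<in># edges (cycles_path L m)"
  shows "e \<subseteq> verts (cycles_path L m)"
  using assms cycle_index_finite[of L]
  by (auto simp: cycles_path_def)

text \<open>By induction over the cycles: a new cycle of length \<open>l\<close> is the copy with
  index \<open>count L l\<close>, whose vertices are not in the old graph, so the map can be
  redefined on them.\<close>

lemma labeling_of_lists:
  assumes "distinct (concat cs @ p)" "p \<noteq> []" "\<And>c. c \<in> set cs \<Longrightarrow> c \<noteq> []"
  defines "G \<equiv> \<lambda>cs. cycles_path (mset (map length cs)) (length p - 1)"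
  shows "\<exists>f. inj_on f (verts (G cs)) \<and> f ` verts (G cs) = set (concat cs @ p) \<and>
    image_mset (\<lambda>e. f ` e) (edges (G cs)) =
      (\<Sum>c\<leftarrow>cs. path_edges (last c # c)) + path_edges p \<and>
    (\<forall>j<length p. f (Pth j) = p ! j)"
  using assms(1,3)
proof (induction cs)
  case Nil
  \<comment> \<open>A bare path has no cycle vertices; \<open>undefined\<close> only makes the
    function total.\<close>
  define f where "f = (\<lambda>v. case v of Pth j \<Rightarrow> p ! j | _ \<Rightarrow> undefined)"
  have V: "verts (G []) = Pth ` {..<length p}"
    using assms(2) by (cases p) (auto simp: G_def cycles_path_def)
  have "edges (G []) = image_mset (\<lambda>j. {Pth j, Pth (Suc j)}) (mset_set {j. Suc j < length p})"
    by (simp add: G_def cycles_path_def less_diff_conv case_prod_unfold)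
  then have "image_mset (\<lambda>e. f ` e) (edges (G [])) = path_edges p"
    by (simp add: path_edges_nth multiset.map_comp o_def f_def)
  moreover have "inj_on f (verts (G []))"
    using Nil by (auto simp: V inj_on_def f_def nth_eq_iff_index_eq)
  moreover have "f ` verts (G []) = set p"
    by (auto simp: V f_def image_iff set_conv_nth)
  ultimately show ?case by (intro exI[of _ f]) (auto simp: f_def)
next
  case (Cons c cs)
  let ?l = "length c" and ?L = "mset (map length cs)"
  define n where "n = count ?L ?l"
  obtain f where f: "inj_on f (verts (G cs))" "f ` verts (G cs) = set (concat cs @ p)"
    "image_mset (\<lambda>e. f ` e) (edges (G cs)) =
      (\<Sum>c\<leftarrow>cs. path_edges (last c # c)) + path_edges p"
    "\<forall>j<length p. f (Pth j) = p ! j"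
    using Cons by auto
  define g where "g = (\<lambda>v. case v of
      Cyc l i j \<Rightarrow> if l = ?l \<and> i = n then c ! j else f v | _ \<Rightarrow> f v)"
  have V: "verts (G (c # cs)) = verts (G cs) \<union> Cyc ?l n ` {..<?l}"
    using verts_add_cycle[of ?l ?L] by (simp add: G_def n_def)
  have E: "edges (G (c # cs)) = edges (G cs) +
      image_mset (\<lambda>j. {Cyc ?l n j, Cyc ?l n (Suc j mod ?l)}) (mset_set {..<?l})"
    using edges_add_cycle[of ?l ?L] by (simp add: G_def n_def)
  have gf: "g v = f v" if "v \<in> verts (G cs)" for v
    using that by (auto simp: g_def n_def G_def cycles_path_def split: vertex.split)
  have gc: "g (Cyc ?l n j) = c ! j" for j by (simp add: g_def)
  have img: "g ` Cyc ?l n ` {..<?l} = set c"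
    unfolding image_image gc by (auto simp: set_conv_nth)
  have gV: "g ` verts (G cs) = set (concat cs @ p)"
    using f(2) gf by (metis image_cong)
  have "inj_on g (verts (G (c # cs)))"
    unfolding V
  proof (intro inj_on_Un[THEN iffD2] conjI)
    show "inj_on g (verts (G cs))" using f(1) gf by (metis inj_on_cong)
    show "inj_on g (Cyc ?l n ` {..<?l})"
      using Cons.prems(1) by (auto simp: inj_on_def gc nth_eq_iff_index_eq)
    have "set c \<inter> set (concat cs @ p) = {}" using Cons.prems(1) by auto
    moreover have "g ` (verts (G cs) - Cyc ?l n ` {..<?l}) \<subseteq> set (concat cs @ p)"
      "g ` (Cyc ?l n ` {..<?l} - verts (G cs)) \<subseteq> set c"
      using gV img by auto
    ultimately show "g ` (verts (G cs) - Cyc ?l n ` {..<?l}) \<inter>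
        g ` (Cyc ?l n ` {..<?l} - verts (G cs)) = {}" by blast
  qed
  moreover have "g ` verts (G (c # cs)) = set (concat (c # cs) @ p)"
    unfolding V image_Un img gV by auto
  moreover have "image_mset (\<lambda>e. g ` e) (edges (G (c # cs))) =
      (\<Sum>c\<leftarrow>c # cs. path_edges (last c # c)) + path_edges p"
  proof -
    have "image_mset (\<lambda>e. g ` e) (edges (G cs)) = image_mset (\<lambda>e. f ` e) (edges (G cs))"
    proof (intro image_mset_cong image_cong refl gf)
      fix e v assume "e \<in># edges (G cs)" "v \<in> e"
      then show "v \<in> verts (G cs)" using edge_subset_verts unfolding G_def by blast
    qed
    moreover have "image_mset (\<lambda>e. g ` e)
        (image_mset (\<lambda>j. {Cyc ?l n j, Cyc ?l n (Suc j mod ?l)}) (mset_set {..<?l})) =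
        path_edges (last c # c)"
      using Cons.prems(2)[of c] by (simp add: closed_path_edges_nth multiset.map_comp o_def gc)
    ultimately show ?thesis unfolding E using f(3) by (simp add: ac_simps)
  qed
  moreover have "\<forall>j<length p. g (Pth j) = p ! j" using f(4) by (simp add: g_def)
  ultimately show ?case by blast
qed

section \<open>Differences of edge multisets\<close>

lemma pm_add [simp]: "pm (A + B) = pm A + pm B"
  by (simp add: pm_def)

lemma pm_empty [simp]: "pm {#} = {#}"
  by (simp add: pm_def)

lemma edge_diffs:
  "u \<noteq> v \<Longrightarrow> image_mset (\<lambda>(u, w). u - w) (mset_set {(u', w). {u', w} = {u, v}}) =
    pm {#\<bar>u - v\<bar> :: int#}"
proof -
  assume "u \<noteq> v"
  moreover have "{(u', w). {u', w} = {u, v}} = {(u, v), (v, u)}"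
    by (auto simp: doubleton_eq_iff)
  ultimately show ?thesis by (auto simp: pm_def abs_if add_mset_commute)
qed

definition diffs_of_edges :: "int set multiset \<Rightarrow> int multiset" where
  "diffs_of_edges E = (\<Sum>e\<in>#E. image_mset (\<lambda>(u, w). u - w) (mset_set {(u, w). {u, w} = e}))"

lemma diffs_of_edges_add [simp]: "diffs_of_edges (E + F) = diffs_of_edges E + diffs_of_edges F"
  by (simp add: diffs_of_edges_def)

lemma diffs_of_edges_empty [simp]: "diffs_of_edges {#} = {#}"
  by (simp add: diffs_of_edges_def)

text \<open>Distinctness is asked of neighbours only, so that the closed list
  \<open>last xs # xs\<close>, which repeats a vertex, is covered.\<close>

lemma diffs_path_edges:
  "successively (\<noteq>) xs \<Longrightarrow> diffs_of_edges (path_edges xs) = pm (path_diffs xs)"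
proof (induction xs rule: path_diffs.induct)
  case (1 u v us)
  then have "diffs_of_edges {#{u, v}#} = pm {#\<bar>u - v\<bar>#}"
    unfolding diffs_of_edges_def using edge_diffs[of u v] by simp
  moreover have "diffs_of_edges (path_edges (v # us)) = pm (path_diffs (v # us))"
    using 1 by simp
  ultimately show ?case
    using diffs_of_edges_add[of "{#{u, v}#}" "path_edges (v # us)"]
      pm_add[of "{#\<bar>u - v\<bar>#}" "path_diffs (v # us)"] by simp
qed auto

lemma distinct_successively: "distinct xs \<Longrightarrow> successively (\<noteq>) xs"
  by (induction xs rule: induct_list012) auto

lemma diffs_closed_path_edges:
  assumes "distinct xs" "2 \<le> length xs"
  shows "diffs_of_edges (path_edges (last xs # xs)) = pm (cycle_diffs xs)"
  unfolding cycle_diffs_def using assms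
  by (intro diffs_path_edges) (cases xs; auto simp: distinct_successively)

lemma labeled_imp_is_GL:
  assumes lab: "labeled a cs p 0 e" and a: "a \<in> {0, 1}"
    and L: "mset (map length cs) = L + replicate_mset a 2" "\<And>l. l \<in># L \<Longrightarrow> 2 < l"
  shows "\<exists>\<Gamma>. is_GL (L + replicate_mset a 2) (length p - 1) \<Gamma> (hd p) (last p)"
    and "e = int (sum_mset L + 2 * a + (length p - 1))"
proof -
  let ?L = "L + replicate_mset a 2" and ?m = "length p - 1"
  have len: "2 \<le> length p" and ms: "mset (concat cs @ p) = mset_set {0..e}"
    and ds: "(\<Sum>c\<leftarrow>cs. cycle_diffs c) + path_diffs p = graceful_diffs a e"
    using lab by (auto simp: labeled_def)
  have dist: "distinct (concat cs @ p)" and set: "set (concat cs @ p) = {0..e}"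
    using mset_eq_mset_setD[OF ms] by simp_all
  have p: "p \<noteq> []" using len by auto
  have cs: "2 \<le> length c" if "c \<in> set cs" for c
  proof -
    have "length c \<in># L + replicate_mset a 2" unfolding L(1)[symmetric] using that by simp
    then show ?thesis using L(2)[of "length c"] by (auto split: if_splits)
  qed
  \<comment> \<open>Counting the labels in the interval and along the lists determines
    \<open>e\<close>.\<close>
  have "int (length (concat cs @ p)) = e + 1"
  proof -
    have "0 \<le> e" using labeled_ends(2)[OF lab] by auto
    moreover have "length (concat cs @ p) = card {0..e}"
      using dist set distinct_card by metis
    ultimately show ?thesis by simp
  qed
  moreover have "length (concat cs) = sum_mset ?L"
    using L(1) by (simp add: length_concat flip: sum_mset_sum_list)
  moreover have "sum_mset ?L = sum_mset L + 2 * a" by simp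
  ultimately show e: "e = int (sum_mset L + 2 * a + ?m)"
    using len by simp
  have "\<And>c. c \<in> set cs \<Longrightarrow> c \<noteq> []" using cs by fastforce
  from labeling_of_lists[OF dist p this] obtain f where f:
    "inj_on f (verts (cycles_path ?L ?m))" "f ` verts (cycles_path ?L ?m) = {0..e}"
    "image_mset (\<lambda>e. f ` e) (edges (cycles_path ?L ?m)) =
      (\<Sum>c\<leftarrow>cs. path_edges (last c # c)) + path_edges p"
    "\<forall>j<length p. f (Pth j) = p ! j"
    unfolding L(1) set by blast
  define \<Gamma> where "\<Gamma> = \<lparr>verts = {0..e}, edges = image_mset (\<lambda>e. f ` e) (edges (cycles_path ?L ?m))\<rparr>"
  have "is_iso f (cycles_path ?L ?m) \<Gamma>"
    unfolding is_iso_def \<Gamma>_def bij_betw_def using f(1,2) by simp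
  moreover have "f (Pth 0) = hd p" "f (Pth ?m) = last p"
    using f(4) p by (auto simp: hd_conv_nth last_conv_nth)
  moreover have "count L 2 = 0"
    using L(2)[of 2] by (auto simp: not_in_iff[symmetric])
  moreover have "diffs \<Gamma> = pm (graceful_diffs a e)"
  proof -
    have "diffs \<Gamma> = diffs_of_edges ((\<Sum>c\<leftarrow>cs. path_edges (last c # c)) + path_edges p)"
      by (simp add: diffs_def diffs_of_edges_def \<Gamma>_def flip: f(3))
    also have "\<dots> = diffs_of_edges (\<Sum>c\<leftarrow>cs. path_edges (last c # c)) + pm (path_diffs p)"
      using dist by (simp add: diffs_path_edges distinct_successively)
    also have "diffs_of_edges (\<Sum>c\<leftarrow>cs. path_edges (last c # c)) = pm (\<Sum>c\<leftarrow>cs. cycle_diffs c)"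
      using dist cs
      by (induction cs) (simp_all add: diffs_closed_path_edges)
    finally show ?thesis by (simp flip: ds)
  qed
  ultimately have "is_GL ?L ?m \<Gamma> (hd p) (last p)"
    unfolding is_GL_def Let_def size_edges_cycles_path
    using a e by (auto simp: \<Gamma>_def graceful_diffs_def simp flip: pm_add)
  then show "\<exists>\<Gamma>. is_GL ?L ?m \<Gamma> (hd p) (last p)" by blast
qed

section \<open>Meeting the bound on the number of edges\<close>

lemma exists_attainable:
  assumes "\<And>l. l \<in># L \<Longrightarrow> odd l \<and> 1 < l" "a \<in> {0, 1}" "L \<noteq> {#}"
  obtains K e where "attainable a (L + replicate_mset a 2) K e"
    "e \<le> 7 ^ (size L + a - 1) * (2 * int (Max (set_mset L)) + 1)"
proof -
  let ?l = "Max (set_mset L)"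
  have l: "?l \<in># L" using assms(3) by (intro Max_in) auto
  obtain K where K: "?l = 2 * K + 1" "0 < K" using assms(1)[OF l] by (auto elim!: oddE)
  have "l \<le> ?l" if "l \<in># L" for l using that by simp
  with assms(1) K(1) have le: "odd l \<and> 1 < l \<and> l \<le> 2 * K + 1" if "l \<in># L" for l
    using that by metis
  \<comment> \<open>This is the size allowed for an initial labeling. For \<open>a = 0\<close> it
    contains a longest cycle, and \<open>size L - 1\<close> cycles are added; for
    \<open>a = 1\<close> it contains the 2-cycle, and all \<open>size L\<close> are added.\<close>
  have bound: "2 * int ?l + 1 = 4 * int K + 3" using K(1) by simp
  consider "a = 0" | "a = 1" using assms(2) by auto
  then show ?thesis
  proof cases
    case 1
    obtain e where e: "attainable 0 {#2 * K + 1#} K e" "e \<le> 4 * int K + 3"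
    proof (cases "K = 1")
      case True
      then show ?thesis using that[of 6] attainable_triangle by simp
    next
      case False
      then show ?thesis using that[of "3 * int K"] attainable_single_cycle[of K] K(2) by simp
    qed
    define M where "M = L - {#?l#}"
    have M: "L = M + {#2 * K + 1#}" using l K(1) by (simp add: M_def)
    obtain e' where e': "attainable 0 (M + {#2 * K + 1#}) K e'" "e' \<le> 7 ^ size M * e"
      using attainable_add_cycles[OF e(1), of M] le by (auto simp: M)
    have "e' \<le> 7 ^ size M * (4 * int K + 3)"
      by (rule order.trans[OF e'(2)]) (use e(2) in simp)
    then have "e' \<le> 7 ^ (size L + a - 1) * (2 * int ?l + 1)"
      unfolding bound using M 1 by simp
    then show ?thesis using e'(1)[folded M] 1 by (intro that[of K e']) simp_all
  next
    case 2
    obtain e where e: "attainable 1 {#2#} K e" "e \<le> 4 * int K + 3"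
      using attainable_digon[OF K(2)] .
    obtain e' where e': "attainable 1 (L + {#2#}) K e'" "e' \<le> 7 ^ size L * e"
      using attainable_add_cycles[OF e(1) le] by blast
    have "e' \<le> 7 ^ size L * (4 * int K + 3)"
      by (rule order.trans[OF e'(2)]) (use e(2) in simp)
    with e'(1) show ?thesis using 2 by (intro that[of K e']) (simp_all add: bound)
  qed
qed

theorem theorem5p7:
  fixes L :: "nat multiset" and a \<epsilon>\<^sub>1 :: nat
  assumes "\<And>l. l \<in># L \<Longrightarrow> odd l \<and> 1 < l"
    and "a \<in> {0, 1}"
    and "\<epsilon>\<^sub>1 = (if L \<noteq> {#} then 7 ^ (size L + a - 1) * (2 * Max (set_mset L) + 1) else 3)"
  shows "\<exists>\<epsilon>\<in>{sum_mset L + 2 * a + 1..\<epsilon>\<^sub>1}. \<exists>\<Gamma> x y.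
           is_GL (L + replicate_mset a 2) (\<epsilon> - sum_mset L - 2 * a) \<Gamma> x y \<and>
           0 \<le> x \<and> real_of_int x \<le> (real \<epsilon> - 1) / 2 \<and> x < y"
proof -
  obtain cs p e where lab: "labeled a cs p 0 e"
    "mset (map length cs) = L + replicate_mset a 2" "hd p < last p" "2 * hd p < e" "e \<le> int \<epsilon>\<^sub>1"
  proof (cases "L = {#}")
    case False
    obtain K e where e: "attainable a (L + replicate_mset a 2) K e"
      "e \<le> 7 ^ (size L + a - 1) * (2 * int (Max (set_mset L)) + 1)"
      using exists_attainable[OF assms(1,2) False] .
    have "e \<le> int \<epsilon>\<^sub>1" using e(2) False by (simp add: assms(3) algebra_simps)
    then show ?thesis using e(1) that unfolding attainable_def by blast
  next
    \<comment> \<open>Without odd cycles, a single edge or the 2-cycle with a one-edge path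
      suffices.\<close>
    case True
    have "{0..1} = {0, 1::int}" by auto
    then have edge: "labeled 0 [] [0, 1] 0 1" by (simp add: labeled_def graceful_diffs_def)
    from assms(2) consider "a = 0" | "a = 1" by auto
    then show ?thesis
    proof cases
      case 1
      then show ?thesis using that[of "[]" "[0, 1]" 1] edge True assms(3) by simp
    next
      case 2
      then show ?thesis using that[of "[[0, 3]]" "[1, 2]" 3] labeled_digon True assms(3)
        by (simp add: numeral_2_eq_2)
    qed
  qed
  let ?m = "length p - 1"
  have "2 < l" if "l \<in># L" for l
    using assms(1)[OF that] by (cases "l = 2") auto
  from labeled_imp_is_GL[OF lab(1) assms(2) lab(2) this]
  obtain \<Gamma> where G: "is_GL (L + replicate_mset a 2) ?m \<Gamma> (hd p) (last p)"
    and e: "e = int (sum_mset L + 2 * a + ?m)"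
    by blast
  let ?\<epsilon> = "sum_mset L + 2 * a + ?m"
  have "0 < ?m" "0 \<le> hd p"
    using lab(1) labeled_ends(2)[OF lab(1)] by (auto simp: labeled_def)
  moreover have "real_of_int (hd p) \<le> (real ?\<epsilon> - 1) / 2"
  proof -
    have "real_of_int x \<le> (real n - 1) / 2" if "2 * x < int n" for x n
    proof -
      have "real_of_int (2 * x + 1) \<le> real_of_int (int n)"
        using that by (intro of_int_le_iff[THEN iffD2]) simp
      then show ?thesis by simp
    qed
    then show ?thesis using lab(4) unfolding e by blast
  qed
  moreover have "?\<epsilon> \<le> \<epsilon>\<^sub>1" using lab(5) e by linarith
  moreover have "?\<epsilon> - sum_mset L - 2 * a = ?m" by simp
  ultimately show ?thesis using G lab(3) by (intro bexI[of _ ?\<epsilon>]) auto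
qed

end
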